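(* For any language $L$ over the unary alphabet $\{a\}$, there exists a bounded-error public-coin interactive proof system for $L$ in which the messages are classical, the verifier is a 2qcfa with a single quantum bit (two quantum basis states), and the expected runtime for inputs of length $n$ is $2^{O(n)}$.
   Context: A two-way finite automaton with quantum and classical states (2qcfa) has a finite set of classical states (with designated initial, accepting and rejecting states), a quantum register with a finite set of quantum basis states and a designated initial quantum state, and a read-only input tape holding the input between a left and a right end-marker, scanned by a two-way head. In each step a superoperator $\mathcal{E}=\{E_1,\dots,E_k\}$ (finitely many square matrices with $\sum_i E_i^\dagger E_i=I$) is applied to the quantum register in state $|\psi\rangle$, yielding outcome $i$ with probability $p_i=\|E_i|\psi\rangle\|^2$ and new state $E_i|\psi\rangle/\sqrt{p_i}$; then the next classical state and head move are determined classically. Transition amplitudes (entries of the operation elements) may be arbitrary real numbers, possibly uncomputable. In a public-coin interactive proof system with a 2qcfa verifier, a prover sends, at each step, a symbol from a finite communication alphabet; the superoperator applied by the verifier is determined by its current classical state, the scanned input symbol and the current communication symbol, and the next classical state and head move are determined by these together with the observed outcome. All outcomes of the verifier's superoperators are immediately visible to the prover, whose messages may be an arbitrary function of the input and the history of outcomes. The system recognizes $L$ with bounded error if there is $\epsilon<1/2$ such that for every $w\in L$ some prover makes the verifier accept $w$ with probability at least $1-\epsilon$, and for every $w\notin L$ the verifier rejects $w$ with probability at least $1-\epsilon$ against every prover. *)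

theory Defs
  imports "HOL-Probability.Probability" "HOL-Library.Landau_Symbols"
begin

datatype 'a tape_symbol = Left_End | Sym 'a | Right_End

datatype head_move = Move_Left | Stay | Move_Right

text \<open>
  Quantum states are vectors indexed by the finite type \<open>'q\<close> of quantum basis states; amplitudes are
  arbitrary reals. Hence the adjoint of an operation element is its transpose, and a single quantum
  bit is the case of the two-element type \<open>2\<close>. A superoperator is the list of its operation elements,
  and its outcomes are the indices of that list.
\<close>

definition superoperator :: "(real^'q^'q) list \<Rightarrow> bool" where
  "superoperator Es \<longleftrightarrow> (\<Sum>E\<leftarrow>Es. transpose E ** E) = mat 1"

record ('c, 'm, 'a, 'q::finite) verifier =
  states :: "'c set"
  start :: 'c
  accepting :: "'c set"
  rejecting :: "'c set"
  qstart :: 'q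
  messages :: "'m set"
  superop :: "'c \<Rightarrow> 'a tape_symbol \<Rightarrow> 'm \<Rightarrow> (real^'q^'q) list"
  delta :: "'c \<Rightarrow> 'a tape_symbol \<Rightarrow> 'm \<Rightarrow> nat \<Rightarrow> 'c \<times> head_move"

definition halting :: "('c, 'm, 'a, 'q::finite) verifier \<Rightarrow> 'c set" where
  "halting V = accepting V \<union> rejecting V"

definition tape_symbols :: "'a set \<Rightarrow> 'a tape_symbol set" where
  "tape_symbols \<Sigma> = {Left_End, Right_End} \<union> Sym ` \<Sigma>"

definition verifier_2qcfa :: "'a set \<Rightarrow> ('c, 'm, 'a, 'q::finite) verifier \<Rightarrow> bool" where
  "verifier_2qcfa \<Sigma> V \<longleftrightarrow>
     finite (states V) \<and> start V \<in> states V \<and>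
     accepting V \<subseteq> states V \<and> rejecting V \<subseteq> states V \<and> accepting V \<inter> rejecting V = {} \<and>
     finite (messages V) \<and> messages V \<noteq> {} \<and>
     (\<forall>s \<in> states V - halting V. \<forall>\<sigma> \<in> tape_symbols \<Sigma>. \<forall>m \<in> messages V.
        superoperator (superop V s \<sigma> m) \<and>
        (\<forall>i < length (superop V s \<sigma> m).
           fst (delta V s \<sigma> m i) \<in> states V \<and>
           (\<sigma> = Left_End \<longrightarrow> snd (delta V s \<sigma> m i) \<noteq> Move_Left) \<and>
           (\<sigma> = Right_End \<longrightarrow> snd (delta V s \<sigma> m i) \<noteq> Move_Right)))"

text \<open>
  A prover maps the input and the outcomes observed so far (oldest first) to its next message. Given
  the input and the prover, this history determines the verifier's entire configuration.
\<close>

type_synonym ('a, 'm) prover = "'a list \<Rightarrow> nat list \<Rightarrow> 'm"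

definition prover_for :: "('c, 'm, 'a, 'q::finite) verifier \<Rightarrow> ('a, 'm) prover \<Rightarrow> bool" where
  "prover_for V P \<longleftrightarrow> (\<forall>w h. P w h \<in> messages V)"

record ('c, 'q::finite) config =
  cstate :: 'c
  head :: nat
  qstate :: "real^'q"
  history :: "nat list"

definition scanned :: "'a list \<Rightarrow> nat \<Rightarrow> 'a tape_symbol" where
  "scanned w p = (if p = 0 then Left_End else if p \<le> length w then Sym (w ! (p - 1)) else Right_End)"

fun move_head :: "head_move \<Rightarrow> nat \<Rightarrow> nat" where
  "move_head Move_Left p = p - 1"
| "move_head Stay p = p"
| "move_head Move_Right p = p + 1"

text \<open>The weights sum to 1 whenever \<open>Es\<close> is a superoperator and \<open>\<psi>\<close> is a unit vector.\<close>

definition outcome_pmf :: "(real^'q^'q) list \<Rightarrow> real^'q \<Rightarrow> nat pmf" where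
  "outcome_pmf Es \<psi> = embed_pmf (\<lambda>i. if i < length Es then (norm (Es ! i *v \<psi>))\<^sup>2 else 0)"

definition initial_config :: "('c, 'm, 'a, 'q::finite) verifier \<Rightarrow> ('c, 'q) config" where
  "initial_config V = \<lparr>cstate = start V, head = 0, qstate = axis (qstart V) 1, history = []\<rparr>"

text \<open>
  Halting configurations are absorbing and no longer extend the history, so that the length of the
  history of a halting configuration is the number of steps taken until halting.
\<close>

definition step ::
  "('c, 'm, 'a, 'q::finite) verifier \<Rightarrow> ('a, 'm) prover \<Rightarrow> 'a list \<Rightarrow> ('c, 'q) config \<Rightarrow> ('c, 'q) config pmf"
where
  "step V P w c =
     (if cstate c \<in> halting V then return_pmf c
      else
        let \<sigma> = scanned w (head c);
            m = P w (history c);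
            Es = superop V (cstate c) \<sigma> m
        in map_pmf
             (\<lambda>i. let (s', d) = delta V (cstate c) \<sigma> m i; \<phi> = Es ! i *v qstate c
                  in \<lparr>cstate = s', head = move_head d (head c), qstate = \<phi> /\<^sub>R norm \<phi>,
                      history = history c @ [i]\<rparr>)
             (outcome_pmf Es (qstate c)))"

primrec run ::
  "('c, 'm, 'a, 'q::finite) verifier \<Rightarrow> ('a, 'm) prover \<Rightarrow> 'a list \<Rightarrow> nat \<Rightarrow> ('c, 'q) config pmf"
where
  "run V P w 0 = return_pmf (initial_config V)"
| "run V P w (Suc t) = bind_pmf (run V P w t) (step V P w)"

text \<open>
  The probability of having halted in a state of \<open>A\<close> (a set of halting states) within \<open>t\<close> steps is
  nondecreasing in \<open>t\<close>; its supremum is the probability of ever doing so.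
\<close>

definition halt_in_prob ::
  "('c, 'm, 'a, 'q::finite) verifier \<Rightarrow> ('a, 'm) prover \<Rightarrow> 'a list \<Rightarrow> 'c set \<Rightarrow> real"
where
  "halt_in_prob V P w A = (SUP t. measure_pmf.prob (run V P w t) {c. cstate c \<in> A})"

definition accept_prob :: "('c, 'm, 'a, 'q::finite) verifier \<Rightarrow> ('a, 'm) prover \<Rightarrow> 'a list \<Rightarrow> real" where
  "accept_prob V P w = halt_in_prob V P w (accepting V)"

definition reject_prob :: "('c, 'm, 'a, 'q::finite) verifier \<Rightarrow> ('a, 'm) prover \<Rightarrow> 'a list \<Rightarrow> real" where
  "reject_prob V P w = halt_in_prob V P w (rejecting V)"

definition runtime_prob :: "('c, 'm, 'a, 'q::finite) verifier \<Rightarrow> ('a, 'm) prover \<Rightarrow> 'a list \<Rightarrow> nat \<Rightarrow> real" where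
  "runtime_prob V P w t =
     measure_pmf.prob (run V P w t) {c. cstate c \<in> halting V \<and> length (history c) = t}"

text \<open>
  The runtime takes the value \<open>\<infinity>\<close> on nonhalting computations; the second summand is 0 iff the
  verifier halts with probability 1, and \<open>\<infinity>\<close> otherwise.
\<close>

definition expected_runtime ::
  "('c, 'm, 'a, 'q::finite) verifier \<Rightarrow> ('a, 'm) prover \<Rightarrow> 'a list \<Rightarrow> ennreal"
where
  "expected_runtime V P w =
     (\<Sum>t. of_nat t * ennreal (runtime_prob V P w t))
     + \<infinity> * ennreal (1 - halt_in_prob V P w (halting V))"

definition bounded_error_proof_system ::
  "'a set \<Rightarrow> 'a list set \<Rightarrow> ('c, 'm, 'a, 'q::finite) verifier \<Rightarrow> bool"
where
  "bounded_error_proof_system \<Sigma> L V \<longleftrightarrow>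
     (\<exists>\<epsilon> < 1/2. \<forall>w \<in> lists \<Sigma>.
        (w \<in> L \<longrightarrow> (\<exists>P. prover_for V P \<and> accept_prob V P w \<ge> 1 - \<epsilon>)) \<and>
        (w \<notin> L \<longrightarrow> (\<forall>P. prover_for V P \<longrightarrow> reject_prob V P w \<ge> 1 - \<epsilon>)))"

end

theory Submission
  imports Defs "HOL-Real_Asymp.Real_Asymp"
begin

text \<open>
  Let \<open>M k\<close> say whether \<open>a\<^sup>k \<in> L\<close>, and let \<open>tail M 1\<close> be the real number with the base-5 expansion
  whose digits are 2 or -2 according to \<open>M 1, M 2, \<dots>\<close>. The qubit holds \<open>(1, x)\<close> up to normalisation,
  starting with \<open>x = tail M 1\<close>. While the head scans the input, the prover claims the digits one by one,
  and an outcome of probability at least 1/200 replaces \<open>x\<close> by \<open>5 * x - 2 * e\<close> for the claimed sign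
  \<open>e\<close>; on every other outcome the verifier returns to the left end and starts again. As long as the
  claims are true, \<open>\<bar>x\<bar> \<le> 1/2\<close>; from the first false claim on, \<open>\<bar>x\<bar> \<ge> 2\<close>. At the right end the qubit
  is measured: the outcome of weight \<open>1 / (1 + x\<^sup>2)\<close> makes the verifier believe the last claim, the
  other one makes it reject. Either way the error is at most 1/5 of the halting probability.

  For the runtime, the length of the history plus a bound on the expected number of remaining steps
  is a supermartingale. Hence the expected history length is bounded at all times, which also forces
  halting with probability 1.
\<close>

section \<open>Runs of a verifier\<close>

lemma sum_list_norm_operation_elements:
  fixes Es :: "(real^'q^'q) list" and \<psi> :: "real^'q"
  shows "(\<Sum>E\<leftarrow>Es. (norm (E *v \<psi>))\<^sup>2) = \<psi> \<bullet> ((\<Sum>E\<leftarrow>Es. transpose E ** E) *v \<psi>)"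
proof (induction Es)
  case (Cons E Es)
  have "(norm (E *v \<psi>))\<^sup>2 = \<psi> \<bullet> ((transpose E ** E) *v \<psi>)"
    by (metis dot_lmul_matrix matrix_vector_mul_assoc power2_norm_eq_inner transpose_matrix_vector
        vector_transpose_matrix)
  then show ?case
    using Cons by (simp add: matrix_vector_mult_add_rdistrib inner_add_right)
qed simp

lemma sum_norm_operation_elements:
  fixes Es :: "(real^'q^'q) list" and \<psi> :: "real^'q"
  assumes "superoperator Es" "norm \<psi> = 1"
  shows "(\<Sum>i<length Es. (norm (Es ! i *v \<psi>))\<^sup>2) = 1"
proof -
  have "(\<Sum>i<length Es. (norm (Es ! i *v \<psi>))\<^sup>2) = (\<Sum>E\<leftarrow>Es. (norm (E *v \<psi>))\<^sup>2)"
    by (simp add: sum_list_sum_nth atLeast0LessThan)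
  also have "\<dots> = 1"
    using assms by (simp add: sum_list_norm_operation_elements superoperator_def norm_eq_1)
  finally show ?thesis .
qed

text \<open>\<open>embed_pmf\<close> is meaningful only for weights of total 1; this is where the
  completeness relation and the unit norm enter.\<close>

lemma pmf_outcome_pmf:
  assumes "superoperator Es" "norm \<psi> = 1"
  shows "pmf (outcome_pmf Es \<psi>) i = (if i < length Es then (norm (Es ! i *v \<psi>))\<^sup>2 else 0)"
  unfolding outcome_pmf_def
proof (rule pmf_embed_pmf)
  let ?f = "\<lambda>i. if i < length Es then (norm (Es ! i *v \<psi>))\<^sup>2 else 0"
  have "(\<integral>\<^sup>+ i. ennreal (?f i) \<partial>count_space UNIV) = (\<Sum>i<length Es. ennreal (?f i))"
    by (rule nn_integral_count_space') auto
  also have "\<dots> = ennreal (\<Sum>i<length Es. ?f i)"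
    by (rule sum_ennreal) auto
  also have "\<dots> = 1"
    using sum_norm_operation_elements[OF assms] by simp
  finally show "(\<integral>\<^sup>+ i. ennreal (?f i) \<partial>count_space UNIV) = 1" .
qed auto

definition step_superop ::
  "('c, 'm, 'a, 'q::finite) verifier \<Rightarrow> ('a, 'm) prover \<Rightarrow> 'a list \<Rightarrow> ('c, 'q) config \<Rightarrow> (real^'q^'q) list"
where
  "step_superop V P w c = superop V (cstate c) (scanned w (head c)) (P w (history c))"

definition successor ::
  "('c, 'm, 'a, 'q::finite) verifier \<Rightarrow> ('a, 'm) prover \<Rightarrow> 'a list \<Rightarrow> ('c, 'q) config \<Rightarrow> nat \<Rightarrow> ('c, 'q) config"
where
  "successor V P w c i =
     (let (s, d) = delta V (cstate c) (scanned w (head c)) (P w (history c)) i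
      in \<lparr>cstate = s, head = move_head d (head c), qstate = sgn (step_superop V P w c ! i *v qstate c),
          history = history c @ [i]\<rparr>)"

lemma step_halted: "cstate c \<in> halting V \<Longrightarrow> step V P w c = return_pmf c"
  by (simp add: step_def)

lemma step_eq_map_successor:
  "cstate c \<notin> halting V \<Longrightarrow>
   step V P w c = map_pmf (successor V P w c) (outcome_pmf (step_superop V P w c) (qstate c))"
  by (simp add: step_def successor_def step_superop_def sgn_div_norm Let_def case_prod_beta
      cong: map_pmf_cong)

lemma set_step:
  assumes "cstate c \<notin> halting V" "superoperator (step_superop V P w c)" "norm (qstate c) = 1"
  shows "set_pmf (step V P w c) =
    successor V P w c ` {i. i < length (step_superop V P w c) \<and> step_superop V P w c ! i *v qstate c \<noteq> 0}"
proof -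
  have "set_pmf (outcome_pmf (step_superop V P w c) (qstate c)) =
    {i. i < length (step_superop V P w c) \<and> step_superop V P w c ! i *v qstate c \<noteq> 0}"
    by (auto simp: set_pmf_eq pmf_outcome_pmf[OF assms(2,3)])
  with assms(1) show ?thesis
    by (simp add: step_eq_map_successor)
qed

lemma expectation_step:
  fixes g :: "('c, 'q::finite) config \<Rightarrow> real"
  assumes "cstate c \<notin> halting V" "superoperator (step_superop V P w c)" "norm (qstate c) = 1"
  shows "measure_pmf.expectation (step V P w c) g =
    (\<Sum>i<length (step_superop V P w c).
       (norm (step_superop V P w c ! i *v qstate c))\<^sup>2 * g (successor V P w c i))"
proof -
  have "measure_pmf.expectation (step V P w c) g =
    measure_pmf.expectation (outcome_pmf (step_superop V P w c) (qstate c)) (\<lambda>i. g (successor V P w c i))"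
    using assms(1) by (simp add: step_eq_map_successor)
  also have "\<dots> = (\<Sum>i<length (step_superop V P w c).
       (norm (step_superop V P w c ! i *v qstate c))\<^sup>2 * g (successor V P w c i))"
    by (subst integral_measure_pmf_real[where A = "{..<length (step_superop V P w c)}"])
      (auto simp: pmf_outcome_pmf[OF assms(2,3)] set_pmf_eq mult.commute split: if_splits)
  finally show ?thesis .
qed

section \<open>Invariants and supermartingales along a run\<close>

definition step_invariant ::
  "('c, 'm, 'a, 'q::finite) verifier \<Rightarrow> ('a, 'm) prover \<Rightarrow> 'a list \<Rightarrow> (('c, 'q) config \<Rightarrow> bool) \<Rightarrow> bool"
where
  "step_invariant V P w I \<longleftrightarrow> I (initial_config V) \<and>
     (\<forall>c. I c \<longrightarrow> cstate c \<notin> halting V \<longrightarrow>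
        superoperator (step_superop V P w c) \<and> norm (qstate c) = 1 \<and>
        (\<forall>i<length (step_superop V P w c). step_superop V P w c ! i *v qstate c \<noteq> 0 \<longrightarrow>
           I (successor V P w c i)))"

context
  fixes V :: "('c, 'm, 'a, 'q::finite) verifier" and P w I
  assumes inv: "step_invariant V P w I"
begin

lemma finite_set_step: "I c \<Longrightarrow> finite (set_pmf (step V P w c))"
  using inv by (cases "cstate c \<in> halting V") (simp_all add: step_halted set_step step_invariant_def)

lemma invariant_step: "I c \<Longrightarrow> c' \<in> set_pmf (step V P w c) \<Longrightarrow> I c'"
  using inv by (cases "cstate c \<in> halting V") (auto simp: step_halted set_step step_invariant_def)

lemma invariant_run: "c \<in> set_pmf (run V P w t) \<Longrightarrow> I c"
proof (induction t arbitrary: c)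
  case 0
  then show ?case using inv by (simp add: step_invariant_def)
qed (auto intro: invariant_step)

text \<open>Finite support makes every real function integrable, so expectations along a run need no
  side conditions.\<close>

lemma finite_set_run: "finite (set_pmf (run V P w t))"
  by (induction t) (auto intro!: finite_set_step invariant_run)

lemma integrable_run: "integrable (measure_pmf (run V P w t)) (g :: _ \<Rightarrow> real)"
  by (rule integrable_measure_pmf_finite[OF finite_set_run])

lemma expectation_run_Suc:
  fixes g :: "('c, 'q) config \<Rightarrow> real"
  shows "measure_pmf.expectation (run V P w (Suc t)) g =
    measure_pmf.expectation (run V P w t) (\<lambda>c. measure_pmf.expectation (step V P w c) g)"
  unfolding run.simps
  by (subst pmf_expectation_bind[where A = "set_pmf (run V P w t)"])
    (auto simp: finite_set_run finite_set_step invariant_run integral_measure_pmf[OF finite_set_run])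

lemma expectation_run_mono:
  fixes g :: "('c, 'q) config \<Rightarrow> real"
  assumes "\<And>c. c \<in> set_pmf (run V P w t) \<Longrightarrow> g c \<le> h c"
  shows "measure_pmf.expectation (run V P w t) g \<le> measure_pmf.expectation (run V P w t) h"
  by (intro integral_mono_AE integrable_run) (simp add: AE_measure_pmf_iff assms)

text \<open>Halted configurations are absorbing, so the supermartingale inequality need only be
  checked before halting. Both the runtime bound and the error bound are instances.\<close>

lemma expectation_run_le_initial:
  fixes g :: "('c, 'q) config \<Rightarrow> real"
  assumes "\<And>c. I c \<Longrightarrow> cstate c \<notin> halting V \<Longrightarrow> measure_pmf.expectation (step V P w c) g \<le> g c"
  shows "measure_pmf.expectation (run V P w t) g \<le> g (initial_config V)"
proof (induction t)
  case (Suc t)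
  have "measure_pmf.expectation (step V P w c) g \<le> g c" if "I c" for c
    using assms[OF that] by (cases "cstate c \<in> halting V") (simp_all add: step_halted)
  then have "measure_pmf.expectation (run V P w (Suc t)) g \<le> measure_pmf.expectation (run V P w t) g"
    unfolding expectation_run_Suc by (intro expectation_run_mono) (auto dest: invariant_run)
  with Suc show ?case by simp
qed simp

lemma history_step:
  "I c \<Longrightarrow> c' \<in> set_pmf (step V P w c) \<Longrightarrow> cstate c \<notin> halting V \<Longrightarrow>
   length (history c') = Suc (length (history c))"
  using inv by (auto simp: set_step step_invariant_def successor_def split: prod.splits)

lemma length_history_unhalted:
  "c \<in> set_pmf (run V P w t) \<Longrightarrow> cstate c \<notin> halting V \<Longrightarrow> length (history c) = t"
proof (induction t arbitrary: c)
  case 0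
  then show ?case by (simp add: initial_config_def)
next
  case (Suc t)
  then obtain d where d: "d \<in> set_pmf (run V P w t)" "c \<in> set_pmf (step V P w d)"
    by auto
  then have "cstate d \<notin> halting V"
    using Suc.prems by (auto simp: step_halted)
  then show ?case
    using Suc.IH[OF d(1)] history_step[OF invariant_run[OF d(1)] d(2)] by simp
qed

lemma prob_run_mono:
  assumes "\<And>c. c \<in> A \<Longrightarrow> cstate c \<in> halting V" "s \<le> t"
  shows "measure_pmf.prob (run V P w s) A \<le> measure_pmf.prob (run V P w t) A"
  using \<open>s \<le> t\<close>
proof (induction t rule: dec_induct)
  case (step t)
  have "indicat_real A c \<le> measure_pmf.expectation (step V P w c) (indicat_real A)" for c
    using assms(1) by (cases "c \<in> A") (simp_all add: step_halted)
  then have "measure_pmf.prob (run V P w t) A \<le> measure_pmf.prob (run V P w (Suc t)) A"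
    using expectation_run_Suc[of t "indicator A"] expectation_run_mono[of t "indicator A"]
    by simp
  with step show ?case by simp
qed simp

lemma halting_prob_eq_unhalted:
  "measure_pmf.prob (run V P w t) {c. cstate c \<in> halting V} =
   1 - measure_pmf.prob (run V P w t) {c. cstate c \<notin> halting V}"
  using measure_pmf.prob_compl[of "{c. cstate c \<notin> halting V}" "run V P w t"]
  by (simp add: Compl_eq_Diff_UNIV[symmetric] Collect_neg_eq[symmetric])

section \<open>Halting and runtime from a bounded expected history length\<close>

context
  fixes B :: real
  assumes B: "\<And>t. measure_pmf.expectation (run V P w t) (\<lambda>c. real (length (history c))) \<le> B"
begin

text \<open>Markov's inequality: an unhalted configuration at time \<open>t\<close> has a history of
  length exactly \<open>t\<close>.\<close>

lemma unhalted_prob_le: "real t * measure_pmf.prob (run V P w t) {c. cstate c \<notin> halting V} \<le> B"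
proof -
  have "real t * measure_pmf.prob (run V P w t) {c. cstate c \<notin> halting V} =
    measure_pmf.expectation (run V P w t) (\<lambda>c. real t * indicator {c. cstate c \<notin> halting V} c)"
    by simp
  also have "\<dots> \<le> measure_pmf.expectation (run V P w t) (\<lambda>c. real (length (history c)))"
    by (intro expectation_run_mono) (auto simp: indicator_def length_history_unhalted)
  finally show ?thesis using B[of t] by simp
qed

lemma halted_prob_tendsto:
  "(\<lambda>t. measure_pmf.prob (run V P w t) {c. cstate c \<in> halting V}) \<longlonglongrightarrow> 1"
proof -
  have "(\<lambda>t. measure_pmf.prob (run V P w t) {c. cstate c \<notin> halting V}) \<longlonglongrightarrow> 0"
  proof (rule tendsto_sandwich[where f = "\<lambda>_. 0" and h = "\<lambda>t. B / real t"])
    show "\<forall>\<^sub>F t in sequentially.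
      measure_pmf.prob (run V P w t) {c. cstate c \<notin> halting V} \<le> B / real t"
      using eventually_gt_at_top[of 0]
      by eventually_elim (use unhalted_prob_le in \<open>simp add: field_simps\<close>)
    show "(\<lambda>t. B / real t) \<longlonglongrightarrow> 0"
      by (rule lim_const_over_n)
  qed auto
  then show ?thesis
    unfolding halting_prob_eq_unhalted by (auto intro: tendsto_eq_intros)
qed

text \<open>Errors are controlled relative to the mass already halted; as that mass tends to 1, the
  limit gives an absolute bound.\<close>

lemma halt_in_prob_ge:
  assumes "\<And>t. \<delta> * measure_pmf.prob (run V P w t) {c. cstate c \<in> halting V}
    \<le> measure_pmf.prob (run V P w t) {c. cstate c \<in> A}"
  shows "\<delta> \<le> halt_in_prob V P w A"
proof (rule LIMSEQ_le_const2)
  show "(\<lambda>t. \<delta> * measure_pmf.prob (run V P w t) {c. cstate c \<in> halting V}) \<longlonglongrightarrow> \<delta>"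
    using tendsto_mult_left[OF halted_prob_tendsto, of \<delta>] by simp
  have "bdd_above (range (\<lambda>t. measure_pmf.prob (run V P w t) {c. cstate c \<in> A}))"
    by (rule bdd_aboveI[of _ 1]) auto
  then show "\<exists>N. \<forall>t\<ge>N. \<delta> * measure_pmf.prob (run V P w t) {c. cstate c \<in> halting V}
    \<le> halt_in_prob V P w A"
    unfolding halt_in_prob_def by (intro exI[of _ 0] allI impI order_trans[OF assms] cSUP_upper) auto
qed

lemma sum_runtime_prob_le:
  "(\<Sum>s<t. real s * runtime_prob V P w s) \<le> B"
proof -
  let ?A = "\<lambda>s. {c. cstate c \<in> halting V \<and> length (history c) = s}"
  \<comment> \<open>Having halted after exactly \<open>s\<close> steps is an absorbing event, so all
    summands can be read off the run at the single time \<open>t\<close>, where at most one of the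
    events holds.\<close>
  have "(\<Sum>s<t. real s * runtime_prob V P w s)
    \<le> (\<Sum>s<t. real s * measure_pmf.prob (run V P w t) (?A s))"
    unfolding runtime_prob_def by (intro sum_mono mult_left_mono prob_run_mono) auto
  also have "\<dots> = (\<Sum>s<t. measure_pmf.expectation (run V P w t) (\<lambda>c. real s * indicator (?A s) c))"
    by simp
  also have "\<dots> = measure_pmf.expectation (run V P w t) (\<lambda>c. \<Sum>s<t. real s * indicator (?A s) c)"
    by (rule Bochner_Integration.integral_sum[symmetric]) (rule integrable_run)
  also have "\<dots> \<le> measure_pmf.expectation (run V P w t) (\<lambda>c. real (length (history c)))"
  proof (rule expectation_run_mono)
    fix c
    have "(\<Sum>s<t. real s * indicator (?A s) c) \<le>
      (\<Sum>s<t. if length (history c) = s then real s else 0)"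
      by (intro sum_mono) (auto simp: indicator_def)
    then show "(\<Sum>s<t. real s * indicator (?A s) c) \<le> real (length (history c))"
      by (auto split: if_splits)
  qed
  finally show ?thesis using B[of t] by simp
qed

lemma expected_runtime_le: "expected_runtime V P w \<le> ennreal B"
proof -
  \<comment> \<open>Halting with probability 1 turns the infinite summand of the expected runtime
    into \<open>\<infinity> * 0 = 0\<close>.\<close>
  have "1 \<le> halt_in_prob V P w (halting V)"
    by (rule halt_in_prob_ge) simp
  then have "ennreal (1 - halt_in_prob V P w (halting V)) = 0"
    by (simp add: ennreal_eq_0_iff)
  moreover have "(\<Sum>s<t. of_nat s * ennreal (runtime_prob V P w s)) \<le> ennreal B" for t
  proof -
    have "(\<Sum>s<t. of_nat s * ennreal (runtime_prob V P w s)) =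
      (\<Sum>s<t. ennreal (real s * runtime_prob V P w s))"
      by (simp add: ennreal_mult' ennreal_of_nat_eq_real_of_nat)
    also have "\<dots> = ennreal (\<Sum>s<t. real s * runtime_prob V P w s)"
      by (rule sum_ennreal) (simp add: runtime_prob_def)
    finally show ?thesis
      using sum_runtime_prob_le by (simp add: ennreal_leI)
  qed
  then have "(\<Sum>t. of_nat t * ennreal (runtime_prob V P w t)) \<le> ennreal B"
    by (intro suminf_le_const summableI)
  ultimately show ?thesis
    by (simp add: expected_runtime_def)
qed

end

end

section \<open>A single qubit as an affine counter\<close>

definition matrix_2 :: "real \<Rightarrow> real \<Rightarrow> real \<Rightarrow> real \<Rightarrow> real^2^2" where
  "matrix_2 a b c d = vector [vector [a, b], vector [c, d]]"

lemma matrix_2_mult [simp]: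
  "matrix_2 a b c d ** matrix_2 a' b' c' d' =
   matrix_2 (a * a' + b * c') (a * b' + b * d') (c * a' + d * c') (c * b' + d * d')"
  by (simp add: matrix_2_def matrix_matrix_mult_def vec_eq_iff forall_2 sum_2)

lemma transpose_matrix_2 [simp]: "transpose (matrix_2 a b c d) = matrix_2 a c b d"
  by (simp add: matrix_2_def transpose_def vec_eq_iff forall_2)

lemma matrix_2_add [simp]:
  "matrix_2 a b c d + matrix_2 a' b' c' d' = matrix_2 (a + a') (b + b') (c + c') (d + d')"
  by (simp add: matrix_2_def vec_eq_iff forall_2)

lemma mat_1_eq_matrix_2: "mat 1 = matrix_2 1 0 0 1"
  by (simp add: matrix_2_def mat_def vec_eq_iff forall_2)

lemma zero_eq_matrix_2: "0 = matrix_2 0 0 0 0"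
  by (simp add: matrix_2_def vec_eq_iff forall_2)

lemma matrix_2_eq_iff [simp]:
  "matrix_2 a b c d = matrix_2 a' b' c' d' \<longleftrightarrow> a = a' \<and> b = b' \<and> c = c' \<and> d = d'"
  by (auto simp: matrix_2_def vec_eq_iff forall_2)

lemma matrix_2_vector [simp]:
  "matrix_2 a b c d *v vector [x, y] = vector [a * x + b * y, c * x + d * y]"
  by (simp add: matrix_2_def matrix_vector_mult_def vec_eq_iff forall_2 sum_2)

lemma power2_norm_vector_2: "(norm (vector [x, y] :: real^2))\<^sup>2 = x\<^sup>2 + y\<^sup>2"
  by (simp add: norm_vec_def L2_set_def sum_2)

lemma vector_2_eq_0_iff [simp]: "(vector [x, y] :: real^2) = 0 \<longleftrightarrow> x = 0 \<and> y = 0"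
  by (simp add: vec_eq_iff forall_2)

lemma vector_2_expand: "\<psi> = vector [\<psi> $ 1, \<psi> $ 2]" for \<psi> :: "real^2"
  by (simp add: vec_eq_iff forall_2)

section \<open>Numbers as ratios of amplitudes\<close>

definition counter :: "real \<Rightarrow> real^2" where
  "counter x = sgn (vector [1, x])"

lemma norm_counter [simp]: "norm (counter x) = 1"
  by (simp add: counter_def norm_sgn)

lemma sgn_counter [simp]: "sgn (counter x) = counter x"
  by (simp add: sgn_div_norm)

lemma mult_counter: "M *v counter x = (1 / norm (vector [1, x] :: real^2)) *\<^sub>R (M *v vector [1, x])"
  by (simp add: counter_def sgn_div_norm matrix_vector_mult_scaleR divide_inverse_commute)

lemma power2_norm_mult_counter:
  "(norm (matrix_2 a b c d *v counter x))\<^sup>2 = ((a + b * x)\<^sup>2 + (c + d * x)\<^sup>2) / (1 + x\<^sup>2)"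
  by (simp add: mult_counter power_divide power2_norm_vector_2)

lemma sgn_mult_counter: "sgn (M *v counter x) = sgn (M *v vector [1, x])"
proof -
  have "norm (vector [1, x] :: real^2) > 0" by simp
  then show ?thesis
    unfolding mult_counter sgn_scaleR by simp
qed

lemma sgn_vector_2_eq_counter:
  assumes "k > 0"
  shows "sgn (vector [k, k * x]) = counter x"
proof -
  have "(vector [k, k * x] :: real^2) = k *\<^sub>R vector [1, x]"
    by (simp add: vec_eq_iff forall_2)
  then show ?thesis
    using assms by (simp add: counter_def sgn_scaleR)
qed

text \<open>
  The factor 1/10 makes the two shifts and a diagonal matrix into a superoperator: opposite digits
  cancel the off-diagonal entries of the sum of the products with the transpose.
\<close>

definition shift_matrix :: "real \<Rightarrow> real^2^2" where
  "shift_matrix e = matrix_2 (1/10) 0 (- e / 5) (1/2)"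

definition shift_superop :: "real \<Rightarrow> (real^2^2) list" where
  "shift_superop e =
     [shift_matrix e, shift_matrix (- e), matrix_2 (sqrt (9/10)) 0 0 (sqrt (1/2))]"

definition measure_superop :: "(real^2^2) list" where
  "measure_superop = [matrix_2 1 0 0 0, matrix_2 0 0 0 1]"

text \<open>The zero matrix at index 0 has weight 0, so idling never yields outcome 0, which a
  prover counting zeros would mistake for an update.\<close>

definition idle_superop :: "(real^2^2) list" where
  "idle_superop = [0, mat 1]"

text \<open>Measures the qubit and prepares \<open>counter x\<close> from either basis state. For
  \<open>x = tail M 1\<close>, its amplitudes carry the language into the verifier.\<close>

definition reset_superop :: "real \<Rightarrow> (real^2^2) list" where
  "reset_superop x =
     (let u = counter x $ 1; v = counter x $ 2 in [0, matrix_2 u 0 v 0, matrix_2 0 u 0 v])"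

lemma superoperator_shift: "e\<^sup>2 = 1 \<Longrightarrow> superoperator (shift_superop e)"
  by (simp add: superoperator_def shift_superop_def shift_matrix_def mat_1_eq_matrix_2
      zero_eq_matrix_2 power2_eq_square)

lemma superoperator_measure: "superoperator measure_superop"
  by (simp add: superoperator_def measure_superop_def mat_1_eq_matrix_2 zero_eq_matrix_2)

lemma superoperator_idle: "superoperator idle_superop"
  by (simp add: superoperator_def idle_superop_def mat_1_eq_matrix_2 zero_eq_matrix_2)

lemma counter_components: "(counter x $ 1)\<^sup>2 + (counter x $ 2)\<^sup>2 = 1"
  using power2_norm_vector_2[of "counter x $ 1" "counter x $ 2"]
  by (simp flip: vector_2_expand)

lemma superoperator_reset: "superoperator (reset_superop x)"
  using counter_components[of x]
  by (simp add: superoperator_def reset_superop_def Let_def mat_1_eq_matrix_2 zero_eq_matrix_2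
      power2_eq_square)

text \<open>The common factor 1/10 is positive and disappears in the normalisation, so the ratio of
  the amplitudes is updated exactly.\<close>

lemma sgn_shift_matrix: "sgn (shift_matrix e *v counter x) = counter (5 * x - 2 * e)"
proof -
  have "shift_matrix e *v vector [1, x] = vector [1/10, 1/10 * (5 * x - 2 * e)]"
    by (simp add: shift_matrix_def algebra_simps)
  then show ?thesis
    by (simp only: sgn_mult_counter sgn_vector_2_eq_counter)
qed

lemma power2_norm_shift_matrix_ge:
  assumes "e\<^sup>2 = 1"
  shows "1/200 \<le> (norm (shift_matrix e *v counter x))\<^sup>2"
proof -
  \<comment> \<open>Completing the square: twice the difference of the sides of the next inequality
    is this square plus 9 - 400/49. Dividing that inequality by 100 gives the constant
    1/200.\<close>
  have "0 \<le> (7 * x - 20/7 * e)\<^sup>2" by simp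
  then have "1/2 * (1 + x\<^sup>2) \<le> 1 + (5 * x - 2 * e)\<^sup>2"
    using assms by (simp add: power2_diff power_mult_distrib power_divide mult.commute[of e])
  then have "1/200 * (1 + x\<^sup>2) \<le> (1/10)\<^sup>2 + (- e / 5 + 1/2 * x)\<^sup>2"
    by (simp add: power2_eq_square algebra_simps)
  moreover have "0 < 1 + x\<^sup>2"
    by (smt (verit) zero_le_power2)
  ultimately show ?thesis
    by (simp add: shift_matrix_def power2_norm_mult_counter pos_le_divide_eq)
qed

lemma reset_matrices:
  fixes \<psi> :: "real^2"
  shows "matrix_2 (counter x $ 1) 0 (counter x $ 2) 0 *v \<psi> = \<psi> $ 1 *\<^sub>R counter x"
    and "matrix_2 0 (counter x $ 1) 0 (counter x $ 2) *v \<psi> = \<psi> $ 2 *\<^sub>R counter x"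
  by (subst vector_2_expand[of \<psi>], subst matrix_2_vector, simp add: vec_eq_iff forall_2)+

section \<open>Verifying the digits of a real number\<close>

definition digit :: "bool \<Rightarrow> real" where
  "digit b = (if b then 1 else -1)"

text \<open>Indexing by the first remaining digit turns the removal of a digit into a step from
  \<open>k\<close> to \<open>Suc k\<close>. The verifier starts from \<open>tail M 1\<close> because
  \<open>M 0\<close> is built into its transition function.\<close>

definition tail :: "(nat \<Rightarrow> bool) \<Rightarrow> nat \<Rightarrow> real" where
  "tail M k = (\<Sum>j. digit (M (k + j)) * (2/5) * (1/5) ^ j)"

lemma digit_power2 [simp]: "(digit b)\<^sup>2 = 1"
  by (simp add: digit_def)

lemma abs_tail_summand: "\<bar>digit (M (k + j)) * (2/5) * (1/5) ^ j\<bar> = 2/5 * (1/5) ^ j"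
  by (simp add: digit_def)

lemma summable_tail_abs: "summable (\<lambda>j. \<bar>digit (M (k + j)) * (2/5) * (1/5) ^ j\<bar>)"
  unfolding abs_tail_summand by (intro summable_mult summable_geometric) simp

text \<open>The geometric series with first term 2/5 and ratio 1/5 sums to 1/2. Digits of size 2 in
  base 5 thus leave a gap between expansions with different leading digits.\<close>

lemma abs_tail_le: "\<bar>tail M k\<bar> \<le> 1/2"
proof -
  have "\<bar>tail M k\<bar> \<le> (\<Sum>j. \<bar>digit (M (k + j)) * (2/5) * (1/5) ^ j\<bar>)"
    unfolding tail_def by (rule summable_rabs[OF summable_tail_abs])
  also have "\<dots> = 1/2"
    unfolding abs_tail_summand by (subst suminf_mult) (simp_all add: suminf_geometric)
  finally show ?thesis .
qed

text \<open>This is the update of \<open>sgn_shift_matrix\<close>, so a true claim turns one tail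
  into the next.\<close>

lemma tail_Suc: "tail M (Suc k) = 5 * tail M k - 2 * digit (M k)"
proof -
  let ?f = "\<lambda>j. digit (M (k + j)) * (2/5) * (1/5) ^ j"
  have "summable ?f"
    by (rule summable_rabs_cancel[OF summable_tail_abs])
  then have "tail M k = ?f 0 + (\<Sum>j. ?f (Suc j))"
    unfolding tail_def using suminf_split_head by fastforce
  also have "(\<Sum>j. ?f (Suc j)) = (\<Sum>j. 1/5 * (digit (M (Suc k + j)) * (2/5) * (1/5) ^ j))"
    by (simp add: mult_ac)
  also have "\<dots> = 1/5 * tail M (Suc k)"
    unfolding tail_def by (intro suminf_mult summable_rabs_cancel[OF summable_tail_abs])
  finally show ?thesis by simp
qed

section \<open>The digit-checking verifier and its reachable configurations\<close>

text \<open>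
  State 0 returns to the left end, states 1 and 2 scan the input, having last received the message 0
  or 1, and states 3 and 4 accept and reject. The message sent at the tape position \<open>p\<close> claims that
  \<open>M p\<close> is false or true; it is subtracted from the counter as the leading base-5 digit.
  Outcome 0 occurs exactly when the counter has been updated, so that a prover finds the position
  of the head by counting the trailing zeros of the history.
\<close>

definition digit_verifier :: "(nat \<Rightarrow> bool) \<Rightarrow> (nat, nat, 'a, 2) verifier" where
  "digit_verifier M =
     \<lparr>states = {..<5}, start = 0, accepting = {3}, rejecting = {4}, qstart = 1, messages = {0, 1},
      superop = (\<lambda>s \<sigma> m.
        if s = 0 then (if \<sigma> = Left_End then reset_superop (tail M 1) else idle_superop)
        else (case \<sigma> of
            Left_End \<Rightarrow> idle_superop
          | Sym _ \<Rightarrow> shift_superop (digit (m = 1))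
          | Right_End \<Rightarrow> measure_superop)),
      delta = (\<lambda>s \<sigma> m i.
        if s = 0 then (if \<sigma> = Left_End then (if M 0 then 2 else 1, Move_Right) else (0, Move_Left))
        else (case \<sigma> of
            Left_End \<Rightarrow> (0, Stay)
          | Sym _ \<Rightarrow> if i = 0 then (Suc m, Move_Right) else (0, Stay)
          | Right_End \<Rightarrow> (if i = 0 \<and> s = 2 then 3 else 4, Stay)))\<rparr>"

lemma digit_verifier_simps [simp]:
  "accepting (digit_verifier M) = {3}" "rejecting (digit_verifier M) = {4}"
  "messages (digit_verifier M) = {0, 1}" "halting (digit_verifier M) = {3, 4}"
  by (auto simp: digit_verifier_def halting_def)

lemma superoperator_digit_verifier: "superoperator (superop (digit_verifier M) s \<sigma> m)"
  by (simp add: digit_verifier_def superoperator_reset superoperator_idle superoperator_shift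
      superoperator_measure split: tape_symbol.split)

lemma verifier_2qcfa_digit_verifier: "verifier_2qcfa \<Sigma> (digit_verifier M)"
  unfolding verifier_2qcfa_def
  by (auto simp: superoperator_digit_verifier)
     (auto simp: digit_verifier_def split: tape_symbol.splits if_splits)

lemma scanned_0 [simp]: "scanned w 0 = Left_End"
  and scanned_Suc: "scanned w (Suc p) = (if p < length w then Sym (w ! p) else Right_End)"
  by (auto simp: scanned_def)

text \<open>
  The parameter \<open>Q p s x h\<close> restricts the configurations scanning position \<open>p + 1\<close> in state \<open>s\<close> with
  counter value \<open>x\<close> and history \<open>h\<close>. The counter is determined only up to a sign of the qubit,
  which the reset cannot remove.
\<close>

inductive reachable ::
  "(nat \<Rightarrow> nat \<Rightarrow> real \<Rightarrow> nat list \<Rightarrow> bool) \<Rightarrow> nat \<Rightarrow> (nat, 2) config \<Rightarrow> bool"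
  for Q n
where
  returning: "p \<le> n \<Longrightarrow> norm \<psi> = 1 \<Longrightarrow> reachable Q n \<lparr>cstate = 0, head = p, qstate = \<psi>, history = h\<rparr>"
| scanning: "p \<le> n \<Longrightarrow> s \<in> {1, 2} \<Longrightarrow> \<bar>k\<bar> = 1 \<Longrightarrow> Q p s x h \<Longrightarrow>
    reachable Q n \<lparr>cstate = s, head = Suc p, qstate = k *\<^sub>R counter x, history = h\<rparr>"
| halted: "s \<in> {3, 4} \<Longrightarrow> reachable Q n \<lparr>cstate = s, head = p, qstate = \<psi>, history = h\<rparr>"

text \<open>Closure under the two events that set the counter: a reset, whose outcome is nonzero,
  and a successful shift. \<open>Q\<close> stays a parameter so that honest and arbitrary provers
  share one analysis.\<close>

definition claims_admissible ::
  "(nat \<Rightarrow> bool) \<Rightarrow> ('a, nat) prover \<Rightarrow> 'a list \<Rightarrow> (nat \<Rightarrow> nat \<Rightarrow> real \<Rightarrow> nat list \<Rightarrow> bool) \<Rightarrow> bool"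
where
  "claims_admissible M P w Q \<longleftrightarrow>
     (\<forall>h i. i \<noteq> 0 \<longrightarrow> Q 0 (if M 0 then 2 else 1) (tail M 1) (h @ [i])) \<and>
     (\<forall>p s x h. p < length w \<longrightarrow> Q p s x h \<longrightarrow>
        Q (Suc p) (Suc (P w h)) (5 * x - 2 * digit (P w h = 1)) (h @ [0]))"

lemma sgn_sign: "\<bar>k\<bar> = 1 \<Longrightarrow> sgn k = k" for k :: real
  by (auto simp: sgn_if abs_if split: if_splits)

lemma lessThan_2: "{..<Suc (Suc 0)} = {0, Suc 0}"
  and lessThan_3: "{..<Suc (Suc (Suc 0))} = {0, Suc 0, Suc (Suc 0)}"
  by auto

context
  fixes M :: "nat \<Rightarrow> bool" and P :: "('a, nat) prover" and w :: "'a list"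
    and Q :: "nat \<Rightarrow> nat \<Rightarrow> real \<Rightarrow> nat list \<Rightarrow> bool" and V :: "(nat, nat, 'a, 2) verifier"
  assumes prover: "P w h \<in> {0, 1}"
    and admissible: "claims_admissible M P w Q"
  defines "V \<equiv> digit_verifier M"
begin

lemma step_invariant_reachable: "step_invariant V P w (reachable Q (length w))"
  unfolding step_invariant_def
proof (intro conjI allI impI)
  show "reachable Q (length w) (initial_config V)"
    by (auto simp: initial_config_def V_def digit_verifier_def intro: returning)
next
  fix c :: "(nat, 2) config"
  show "superoperator (step_superop V P w c)"
    by (simp add: step_superop_def V_def superoperator_digit_verifier)
next
  fix c assume "reachable Q (length w) c" "cstate c \<notin> halting V"
  then show "norm (qstate c) = 1"
    by cases (auto simp: V_def)
next
  fix c i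
  assume c: "reachable Q (length w) c" "cstate c \<notin> halting V"
    and i: "i < length (step_superop V P w c)" "step_superop V P w c ! i *v qstate c \<noteq> 0"
  from c show "reachable Q (length w) (successor V P w c i)"
  proof cases
    case (returning p \<psi> h)
    show ?thesis
    proof (cases p)
      case 0
      \<comment> \<open>Element 0 of the reset is zero; the others have nonzero weight only if the
        measured amplitude is nonzero, which makes its sign 1 or -1.\<close>
      with i returning have i': "i = 1 \<and> \<psi> $ 1 \<noteq> 0 \<or> i = 2 \<and> \<psi> $ 2 \<noteq> 0"
        by (auto simp: step_superop_def V_def digit_verifier_def reset_superop_def Let_def less_Suc_eq
            numeral_2_eq_2 reset_matrices)
      then have "sgn (step_superop V P w c ! i *v qstate c) =
        sgn (\<psi> $ (if i = 1 then 1 else 2)) *\<^sub>R counter (tail M 1)"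
        using returning 0
        by (auto simp: step_superop_def V_def digit_verifier_def reset_superop_def Let_def
            reset_matrices sgn_scaleR)
      moreover have "\<bar>sgn (\<psi> $ (if i = 1 then 1 else 2))\<bar> = 1"
        using i' by (auto simp: abs_sgn_eq)
      ultimately show ?thesis
        using returning 0 i' admissible
        by (auto simp: successor_def V_def digit_verifier_def claims_admissible_def
            intro!: reachable.scanning)
    next
      case (Suc q)
      with i returning show ?thesis
        by (auto simp: successor_def step_superop_def V_def digit_verifier_def scanned_Suc
            norm_sgn intro!: reachable.returning split: if_splits)
    qed
  next
    case (scanning p s k x h)
    show ?thesis
    proof (cases "p < length w")
      case True
      show ?thesis
      proof (cases "i = 0")
        case i0: True
        have post: "sgn (step_superop V P w c ! 0 *v qstate c) =
          k *\<^sub>R counter (5 * x - 2 * digit (P w h = 1))"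
          using scanning True
          by (auto simp: step_superop_def V_def digit_verifier_def scanned_Suc shift_superop_def
              matrix_vector_mult_scaleR sgn_scaleR sgn_sign sgn_shift_matrix)
        have "successor V P w c i = \<lparr>cstate = Suc (P w h), head = Suc (Suc p),
            qstate = k *\<^sub>R counter (5 * x - 2 * digit (P w h = 1)), history = h @ [0]\<rparr>"
          unfolding successor_def i0 post
          using scanning True by (auto simp: V_def digit_verifier_def scanned_Suc)
        moreover have "Q (Suc p) (Suc (P w h)) (5 * x - 2 * digit (P w h = 1)) (h @ [0])"
          using scanning True admissible by (simp add: claims_admissible_def)
        ultimately show ?thesis
          using scanning True prover[of h] by (auto intro!: reachable.scanning)
      next
        \<comment> \<open>A failed shift leaves an uncontrolled qubit; only its unit norm matters,
          since the next reset overwrites it.\<close>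
        case False
        then have "successor V P w c i = \<lparr>cstate = 0, head = Suc p,
            qstate = sgn (step_superop V P w c ! i *v qstate c), history = h @ [i]\<rparr>"
          using scanning True by (auto simp: successor_def V_def digit_verifier_def scanned_Suc)
        moreover have "norm (sgn (step_superop V P w c ! i *v qstate c)) = 1"
          using i by (simp add: norm_sgn)
        ultimately show ?thesis
          using True by (auto intro!: reachable.returning)
      qed
    next
      case False
      with scanning show ?thesis
        by (auto simp: successor_def V_def digit_verifier_def scanned_Suc intro!: reachable.halted)
    qed
  next
    case halted
    with c show ?thesis by (auto simp: V_def)
  qed
qed

lemmas reachable_run = step_invariant_reachable[THEN invariant_run]

lemma expectation_step_reachable:
  fixes g :: "(nat, 2) config \<Rightarrow> real"
  assumes "reachable Q (length w) c" "cstate c \<notin> halting V"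
  shows "measure_pmf.expectation (step V P w c) g =
    (\<Sum>i<length (step_superop V P w c).
       (norm (step_superop V P w c ! i *v qstate c))\<^sup>2 * g (successor V P w c i))"
  using assms step_invariant_reachable by (intro expectation_step) (auto simp: step_invariant_def)

section \<open>Expected runtime\<close>

text \<open>
  Bounds the expected number of remaining steps. Each update of the counter succeeds with
  probability at least 1/200, and the base 201 leaves room for the cost of the step itself.
\<close>

definition remaining :: "(nat, 2) config \<Rightarrow> real" where
  "remaining c =
     (let n = real (length w); C = (n + 2) * 201 ^ length w
      in if cstate c = 0 then C + real (head c) - n
         else if cstate c \<in> {1, 2} then C + 1 - (n + 2) * 201 ^ (head c - 1)
         else 0)"

lemma remaining_nonneg:
  assumes "reachable Q (length w) c"
  shows "0 \<le> remaining c"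
  using assms
proof cases
  case returning
  have "real (length w) * 1 \<le> real (length w) * 201 ^ length w"
    by (intro mult_left_mono) auto
  moreover have "(0::real) \<le> 2 * 201 ^ length w" by simp
  ultimately show ?thesis
    using returning by (auto simp: remaining_def Let_def ring_distribs intro: order_trans add_increasing2)
next
  case (scanning p)
  have "(real (length w) + 2) * 201 ^ p \<le> (real (length w) + 2) * 201 ^ length w"
    using scanning by (intro mult_left_mono power_increasing) auto
  moreover have "remaining c = (real (length w) + 2) * 201 ^ length w + 1 - (real (length w) + 2) * 201 ^ p"
    using scanning by (auto simp: remaining_def Let_def)
  ultimately show ?thesis by linarith
next
  case halted
  then show ?thesis by (auto simp: remaining_def)
qed

lemma expectation_step_remaining:
  assumes c: "reachable Q (length w) c" "cstate c \<notin> halting V"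
  shows "measure_pmf.expectation (step V P w c) (\<lambda>c. real (length (history c)) + remaining c)
    \<le> real (length (history c)) + remaining c"
proof -
  let ?g = "\<lambda>c. real (length (history c)) + remaining c"
  let ?C = "(real (length w) + 2) * 201 ^ length w"
  note E = expectation_step_reachable[OF c, of ?g]
  have total: "(\<Sum>i<length (step_superop V P w c). (norm (step_superop V P w c ! i *v qstate c))\<^sup>2) = 1"
    using step_invariant_reachable c
    by (intro sum_norm_operation_elements) (auto simp: step_invariant_def)
  \<comment> \<open>Enough for every step except a shift, where the gain from success has to be
    averaged.\<close>
  have le: "measure_pmf.expectation (step V P w c) ?g \<le> b"
    if "\<And>i. i < length (step_superop V P w c) \<Longrightarrow>
      step_superop V P w c ! i *v qstate c \<noteq> 0 \<Longrightarrow> ?g (successor V P w c i) \<le> b" for b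
  proof -
    have "measure_pmf.expectation (step V P w c) ?g \<le>
      (\<Sum>i<length (step_superop V P w c). (norm (step_superop V P w c ! i *v qstate c))\<^sup>2 * b)"
      unfolding E
      by (intro sum_mono) (metis lessThan_iff mult_left_mono mult_zero_left norm_zero order_refl
          that zero_le_power2 zero_power2)
    then show ?thesis
      using total by (simp flip: sum_distrib_right)
  qed
  from c show ?thesis
  proof cases
    case (returning p \<psi> h)
    \<comment> \<open>\<open>remaining\<close> falls by 1 in either case. At the left end it goes
      from \<open>C - n\<close> to \<open>C + 1 - (n + 2)\<close>, whence the factor
      \<open>n + 2\<close>.\<close>
    show ?thesis
    proof (rule le, goal_cases)
      case (1 i)
      with returning show ?case
        by (cases p) (auto simp: successor_def step_superop_def V_def digit_verifier_def
            scanned_Suc remaining_def Let_def split: if_splits)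
    qed
  next
    case (scanning p s k x h)
    show ?thesis
    proof (cases "p < length w")
      case False
      with scanning show ?thesis
        by (intro le) (auto simp: successor_def V_def digit_verifier_def scanned_Suc remaining_def)
    next
      case True
      define e where "e = digit (P w h = 1)"
      define D where "D = (real (length w) + 2) * 201 ^ p"
      define r where "r = (norm (shift_matrix e *v counter x))\<^sup>2"
      define b where "b = real (length h) + 1 + ?C"
      have Es: "step_superop V P w c = shift_superop e"
        using scanning True by (auto simp: step_superop_def V_def digit_verifier_def scanned_Suc e_def)
      have r: "(norm (step_superop V P w c ! 0 *v qstate c))\<^sup>2 = r"
        unfolding Es using scanning by (simp add: shift_superop_def r_def matrix_vector_mult_scaleR)
      have success: "?g (successor V P w c 0) = b + 1 - 201 * D"
        using scanning True prover[of h]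
        by (auto simp: successor_def V_def digit_verifier_def scanned_Suc remaining_def Let_def
            b_def D_def)
      have failure: "?g (successor V P w c i) \<le> b" if "i \<noteq> 0" for i
        using scanning True that
        by (auto simp: successor_def V_def digit_verifier_def scanned_Suc remaining_def Let_def b_def)
      define f where "f i = (norm (step_superop V P w c ! i *v qstate c))\<^sup>2" for i
      have "measure_pmf.expectation (step V P w c) ?g =
        f 0 * ?g (successor V P w c 0) + (f 1 * ?g (successor V P w c 1) + f 2 * ?g (successor V P w c 2))"
        by (subst E) (simp add: f_def Es shift_superop_def lessThan_3 numeral_2_eq_2)
      also have "\<dots> \<le> f 0 * (b + 1 - 201 * D) + (f 1 * b + f 2 * b)"
        unfolding success by (intro add_mono mult_left_mono failure) (auto simp: f_def)
      also have "\<dots> = (f 0 + f 1 + f 2) * b - r * (201 * D - 1)"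
        by (simp add: r f_def algebra_simps)
      also have "f 0 + f 1 + f 2 = 1"
        using total by (simp add: f_def Es shift_superop_def lessThan_3 numeral_2_eq_2)
      \<comment> \<open>As \<open>D\<close> is at least 1, \<open>201 * D - 1\<close> is at least
        \<open>200 * D\<close>; the success probability \<open>r\<close> of at least 1/200 then pays
        for \<open>D\<close>.\<close>
      also have "1 * b - r * (201 * D - 1) \<le> b - D"
      proof -
        have "1 * 1 \<le> D"
          unfolding D_def by (intro mult_mono) auto
        then have "1/200 * (200 * D) \<le> r * (201 * D - 1)"
          using power2_norm_shift_matrix_ge[of e x] by (intro mult_mono) (auto simp: r_def e_def)
        then show ?thesis by simp
      qed
      also have "\<dots> = ?g c"
        using scanning by (auto simp: b_def D_def remaining_def Let_def)
      finally show ?thesis .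
    qed
  next
    case halted
    with c show ?thesis by (auto simp: V_def)
  qed
qed

lemma expectation_length_history:
  "measure_pmf.expectation (run V P w t) (\<lambda>c. real (length (history c)))
   \<le> (real (length w) + 2) * 201 ^ length w"
proof -
  have "measure_pmf.expectation (run V P w t) (\<lambda>c. real (length (history c)))
    \<le> measure_pmf.expectation (run V P w t) (\<lambda>c. real (length (history c)) + remaining c)"
    using remaining_nonneg reachable_run
    by (intro expectation_run_mono[OF step_invariant_reachable]) fastforce
  also have "\<dots> \<le> real (length (history (initial_config V))) + remaining (initial_config V)"
    by (rule expectation_run_le_initial[OF step_invariant_reachable expectation_step_remaining])
  also have "\<dots> \<le> (real (length w) + 2) * 201 ^ length w"
    by (simp add: initial_config_def V_def digit_verifier_def remaining_def Let_def)
  finally show ?thesis .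
qed

lemmas expected_runtime_digit_verifier =
  expected_runtime_le[OF step_invariant_reachable expectation_length_history]

section \<open>Error probability, with \<open>\<beta>\<close> the wrong and \<open>\<gamma>\<close>
  the right verdict\<close>

context
  fixes \<gamma> \<beta> :: nat
  assumes \<beta>\<gamma>: "{\<beta>, \<gamma>} = {3, 4}"
    and error: "\<And>s x h. Q (length w) s x h \<Longrightarrow> s \<in> {1, 2} \<Longrightarrow>
      \<beta> = 3 \<and> (s = 2 \<longrightarrow> 2 \<le> \<bar>x\<bar>) \<or> \<beta> = 4 \<and> s = 2 \<and> \<bar>x\<bar> \<le> 1/2"
begin

text \<open>Only the final measurement can halt. Its outcomes have weights 1 and
  \<open>x\<^sup>2\<close> over \<open>1 + x\<^sup>2\<close>, so 1/5 bounds both wrong acceptance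
  for \<open>2 \<le> \<bar>x\<bar>\<close> and wrong rejection for
  \<open>\<bar>x\<bar> \<le> 1/2\<close>.\<close>

lemma expectation_step_error:
  assumes c: "reachable Q (length w) c" "cstate c \<notin> halting V"
  shows "measure_pmf.expectation (step V P w c)
    (\<lambda>c. indicat_real {c. cstate c = \<beta>} c - 1/5 * indicat_real {c. cstate c \<in> halting V} c)
    \<le> 0"
proof -
  let ?g = "\<lambda>c. indicat_real {c. cstate c = \<beta>} c - 1/5 * indicat_real {c. cstate c \<in> halting V} c"
  note E = expectation_step_reachable[OF c, of ?g]
  have \<beta>: "\<beta> \<in> {3, 4}" using \<beta>\<gamma> by auto
  have unhalted: ?thesis if "\<And>i. i < length (step_superop V P w c) \<Longrightarrow> cstate (successor V P w c i) \<notin> {3, 4}"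
    unfolding E
  proof (intro sum_nonpos mult_nonneg_nonpos)
    fix i assume "i \<in> {..<length (step_superop V P w c)}"
    with that[of i] \<beta> show "?g (successor V P w c i) \<le> 0"
      by (auto simp: V_def)
  qed simp
  from c show ?thesis
  proof cases
    case (returning p \<psi> h)
    then show ?thesis
      by (intro unhalted) (auto simp: successor_def V_def digit_verifier_def split: if_splits)
  next
    case (scanning p s k x h)
    show ?thesis
    proof (cases "p < length w")
      case True
      with scanning prover[of h] show ?thesis
        by (intro unhalted) (auto simp: successor_def V_def digit_verifier_def scanned_Suc)
    next
      case False
      then have p: "p = length w" using scanning by simp
      have halting: "halting V = {3, 4}" by (simp add: V_def)
      have q: "qstate c = k *\<^sub>R counter x" using scanning by simp
      have pos: "0 < 1 + x\<^sup>2"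
        by (smt (verit) zero_le_power2)
      have Es: "step_superop V P w c = measure_superop"
        using scanning p by (auto simp: step_superop_def V_def digit_verifier_def scanned_Suc)
      have succ: "cstate (successor V P w c i) = (if i = 0 \<and> s = 2 then 3 else 4)" for i
        using scanning p by (auto simp: successor_def V_def digit_verifier_def scanned_Suc)
      have "measure_pmf.expectation (step V P w c) ?g =
        1 / (1 + x\<^sup>2) * ?g (successor V P w c 0) + x\<^sup>2 / (1 + x\<^sup>2) * ?g (successor V P w c 1)"
        unfolding E Es using q \<open>\<bar>k\<bar> = 1\<close>
        by (simp add: measure_superop_def lessThan_2 matrix_vector_mult_scaleR power2_norm_mult_counter)
      also have "\<dots> = (?g (successor V P w c 0) + x\<^sup>2 * ?g (successor V P w c 1)) / (1 + x\<^sup>2)"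
        by (simp add: add_divide_distrib)
      also have "\<dots> \<le> 0"
      proof -
        have "?g (successor V P w c 0) + x\<^sup>2 * ?g (successor V P w c 1) \<le> 0"
        proof -
          from error[of s x h] scanning p consider
              "\<beta> = 3" "s = 1" | "\<beta> = 3" "s = 2" "2 \<le> \<bar>x\<bar>" | "\<beta> = 4" "s = 2" "\<bar>x\<bar> \<le> 1/2"
            by auto
          then show ?thesis
          proof cases
            \<comment> \<open>State 1 rejects on either outcome, which is the right verdict
              here.\<close>
            case 1
            with pos show ?thesis by (simp add: succ halting)
          next
            case 2
            then have "2\<^sup>2 \<le> x\<^sup>2" by (metis abs_le_square_iff abs_numeral)
            with 2 show ?thesis by (simp add: succ halting)
          next
            case 3
            then have "x\<^sup>2 \<le> (1/2)\<^sup>2" by (simp add: abs_le_square_iff[symmetric])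
            with 3 show ?thesis by (simp add: succ halting power2_eq_square)
          qed
        qed
        with pos show ?thesis by (simp add: divide_le_0_iff)
      qed
      finally show ?thesis .
    qed
  next
    case halted
    with c show ?thesis by (auto simp: V_def)
  qed
qed

text \<open>The supermartingale starts at 0, so at every time at most 1/5 of the halted mass has the
  wrong verdict.\<close>

lemma halt_in_prob_digit_verifier: "4/5 \<le> halt_in_prob V P w {\<gamma>}"
proof (rule halt_in_prob_ge[OF step_invariant_reachable expectation_length_history])
  fix t
  let ?p = "\<lambda>A. measure_pmf.prob (run V P w t) {c. cstate c \<in> A}"
  let ?g = "\<lambda>c. indicat_real {c. cstate c = \<beta>} c - 1/5 * indicat_real {c. cstate c \<in> halting V} c"
  have neq: "\<beta> \<noteq> \<gamma>" and halting: "halting V = {\<beta>, \<gamma>}"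
    using \<beta>\<gamma> by (auto simp: V_def doubleton_eq_iff)
  have "measure_pmf.expectation (run V P w t) ?g \<le> ?g (initial_config V)"
    using expectation_step_error
    by (intro expectation_run_le_initial[OF step_invariant_reachable]) (fastforce simp: halting)
  also have "\<dots> \<le> 0"
    using \<beta>\<gamma> by (auto simp: initial_config_def V_def digit_verifier_def indicator_def
        doubleton_eq_iff)
  also have "measure_pmf.expectation (run V P w t) ?g = ?p {\<beta>} - 1/5 * ?p (halting V)"
    by (subst Bochner_Integration.integral_diff) (auto simp: integrable_run[OF step_invariant_reachable])
  finally have "?p {\<beta>} \<le> 1/5 * ?p (halting V)" by simp
  moreover have "?p (halting V) = ?p {\<beta>} + ?p {\<gamma>}"
  proof -
    have "{c :: (nat, 2) config. cstate c \<in> halting V} = {c. cstate c \<in> {\<beta>}} \<union> {c. cstate c \<in> {\<gamma>}}"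
      by (auto simp: halting)
    then show ?thesis
      using neq by (simp add: measure_pmf.finite_measure_Union disjoint_iff)
  qed
  ultimately show "4/5 * ?p (halting V) \<le> ?p {\<gamma>}" by simp
qed

end

end

section \<open>Soundness and completeness\<close>

text \<open>After a false claim the counter is too large for any later digits to bring it back.\<close>

lemma claims_admissible_sound:
  assumes "\<And>h. P w h \<in> {0, 1}"
  shows "claims_admissible M P w (\<lambda>p s x h. x = tail M (Suc p) \<and> (s = 2 \<longleftrightarrow> M p) \<or> 2 \<le> \<bar>x\<bar>)"
proof -
  \<comment> \<open>A true claim gives the next tail. A false one is off by 4, leaving at least 7/2,
    and \<open>2 \<le> \<bar>x\<bar>\<close> grows to at least 8.\<close>
  have step: "5 * x - 2 * digit c = tail M (Suc (Suc p)) \<and> (c \<longleftrightarrow> M (Suc p)) \<or>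
      2 \<le> \<bar>5 * x - 2 * digit c\<bar>"
    if "x = tail M (Suc p) \<or> 2 \<le> \<bar>x\<bar>" for x p c
    using that abs_tail_le[of M "Suc (Suc p)"] tail_Suc[of M "Suc p"]
    by (auto simp: digit_def abs_if split: if_splits)
  have "Suc m = 2 \<longleftrightarrow> m = 1" for m by auto
  with step show ?thesis
    by (auto simp: claims_admissible_def)
qed

text \<open>With \<open>p\<close> trailing zeros during a scan, the head is at position
  \<open>p + 1\<close>, hence \<open>Suc\<close>. Messages sent outside the scan of input symbols
  are ignored by the verifier.\<close>

definition honest_prover :: "(nat \<Rightarrow> bool) \<Rightarrow> ('a, nat) prover" where
  "honest_prover M w h = of_bool (M (Suc (length (takeWhile ((=) 0) (rev h)))))"

text \<open>A reset appends a nonzero outcome, which restarts the count; each update appends one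
  zero.\<close>

lemma claims_admissible_honest:
  "claims_admissible M (honest_prover M) w
     (\<lambda>p s x h. p = length (takeWhile ((=) 0) (rev h)) \<and> x = tail M (Suc p) \<and> (s = 2 \<longleftrightarrow> M p))"
  by (auto simp: claims_admissible_def honest_prover_def tail_Suc)

lemma honest_prover_messages: "honest_prover M w h \<in> {0, 1}"
  by (simp add: honest_prover_def)

theorem theorem2:
  fixes a :: 'a and L :: "'a list set"
  assumes "L \<subseteq> lists {a}"
  shows "\<exists>V :: (nat, nat, 'a, 2) verifier.
           verifier_2qcfa {a} V \<and>
           bounded_error_proof_system {a} L V \<and>
           (\<exists>f \<in> O(\<lambda>n. real n). \<forall>w \<in> lists {a}. \<forall>P. prover_for V P \<longrightarrow>
              expected_runtime V P w \<le> ennreal (2 powr f (length w)))"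
proof -
  define M where "M k \<longleftrightarrow> replicate k a \<in> L" for k
  let ?V = "digit_verifier M :: (nat, nat, 'a, 2) verifier"
  have M: "M (length w) \<longleftrightarrow> w \<in> L" if "w \<in> lists {a}" for w
  proof -
    have "w = replicate (length w) a"
      using that by (induction w) auto
    then show ?thesis by (simp add: M_def)
  qed
  have messages: "P w h \<in> {0, 1}" if "prover_for ?V P" for P w h
    using that by (simp add: prover_for_def)
  have "bounded_error_proof_system {a} L ?V"
    unfolding bounded_error_proof_system_def
  proof (intro exI[of _ "1/5"] conjI ballI impI allI)
    fix w :: "'a list" assume w: "w \<in> lists {a}" "w \<in> L"
    have "4/5 \<le> halt_in_prob ?V (honest_prover M) w {3}"
      using w M[OF w(1)] abs_tail_le[of M "Suc (length w)"]
      \<comment> \<open>The wrong verdict is 4. The last claim is true and \<open>w \<in> L\<close>,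
        so the state is 2 and the counter is a tail.\<close>
      by (intro halt_in_prob_digit_verifier[OF honest_prover_messages claims_admissible_honest, of 4])
        auto
    then show "\<exists>P. prover_for ?V P \<and> 1 - 1/5 \<le> accept_prob ?V P w"
      by (intro exI[of _ "honest_prover M"])
        (simp add: prover_for_def accept_prob_def honest_prover_def)
  next
    fix w :: "'a list" and P assume w: "w \<in> lists {a}" "w \<notin> L" and P: "prover_for ?V P"
    have "4/5 \<le> halt_in_prob ?V P w {4}"
      using w M[OF w(1)]
      \<comment> \<open>The wrong verdict is 3. In state 2 the last claim is false since
        \<open>w \<notin> L\<close>, which leaves only \<open>2 \<le> \<bar>x\<bar>\<close>.\<close>
      by (intro halt_in_prob_digit_verifier[OF messages[OF P] claims_admissible_sound[OF messages[OF P]], of 3])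
        auto
    then show "1 - 1/5 \<le> reject_prob ?V P w"
      by (simp add: reject_prob_def)
  qed simp
  moreover have "\<exists>f \<in> O(\<lambda>n. real n). \<forall>w \<in> lists {a}. \<forall>P. prover_for ?V P \<longrightarrow>
      expected_runtime ?V P w \<le> ennreal (2 powr f (length w))"
  proof (intro bexI ballI allI impI)
    fix w :: "'a list" and P assume P: "prover_for ?V P"
    let ?n = "length w"
    have "expected_runtime ?V P w \<le> ennreal ((real ?n + 2) * 201 ^ ?n)"
      by (rule expected_runtime_digit_verifier[OF messages[OF P] claims_admissible_sound[OF messages[OF P]]])
    also have "\<dots> \<le> ennreal (2 powr (9 * real ?n + 1))"
    proof (rule ennreal_leI)
      have "real n + 2 \<le> 2 * 2 ^ n" for n
        by (induction n) auto
      \<comment> \<open>In the exponent, 201 < 256 = 2^8 contributes \<open>8 * ?n\<close>, and the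
        linear factor contributes \<open>?n + 1\<close>.\<close>
      then have "(real ?n + 2) * 201 ^ ?n \<le> (2 * 2 ^ ?n) * 256 ^ ?n"
        by (intro mult_mono power_mono) auto
      also have "\<dots> = 2 powr (9 * real ?n + 1)"
      proof -
        have "(256::real) ^ ?n = 2 ^ (8 * ?n)" by (simp add: power_mult)
        then have "(2 * 2 ^ ?n) * (256::real) ^ ?n = 2 ^ (9 * ?n + 1)"
          by (simp flip: power_add)
        then show ?thesis using powr_realpow[of 2 "9 * ?n + 1"] by (simp add: add.commute)
      qed
      finally show "(real ?n + 2) * 201 ^ ?n \<le> 2 powr (9 * real ?n + 1)" .
    qed
    finally show "expected_runtime ?V P w \<le> ennreal (2 powr (9 * real ?n + 1))" .
  next
    show "(\<lambda>n. 9 * real n + 1) \<in> O(\<lambda>n. real n)"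
      by real_asymp
  qed
  ultimately show ?thesis
    using verifier_2qcfa_digit_verifier by blast
qed

end
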